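(* For the network $Q_n(8,4)$, the Möbius graph of the linear octagonal-quadrilateral network with $n$ octagons and $n$ quadrilaterals, $$W\big(Q_n(8,4)\big)=32n^3+16n^2+4n.$$
   Context: Here $n$ is a positive integer. The linear octagonal-quadrilateral network $L_n^{8,4}$ consists of $n$ eight-membered rings and $n$ four-membered rings arranged alternately in a line, consecutive rings sharing a common edge. The Möbius graph $Q_n(8,4)$ is obtained from $L_n^{8,4}$ by identifying its two opposite end edges in reverse. Explicitly, $Q_n(8,4)$ is the simple undirected graph with $8n$ vertices $1,2,\dots,4n,1',2',\dots,(4n)'$ and the following $10n$ edges: the path edges $\{j,j+1\}$ and $\{j',(j+1)'\}$ for $1\le j\le 4n-1$; the rungs $\{j,j'\}$ for all $1\le j\le 4n$ with $j\equiv 0$ or $1 \pmod 4$; and the two twisted closing edges $\{4n,1'\}$ and $\{(4n)',1\}$. For a connected graph $G$, the Wiener index is $W(G)=\sum_{i<j} d_{ij}$, where $d_{ij}$ is the length of a shortest path between vertices $i$ and $j$, and the sum is over all unordered pairs of distinct vertices.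
   Formalization: The formal theorem assumes n ≥ 2 instead of n a positive integer, because the formula fails at n = 1: the graph Q_1(8,4) has Wiener index 50, whereas the formula gives 52. *)

theory Defs
  imports Main "HOL-Library.Product_Lexorder"
begin

text \<open>A simple graph is given by its vertex set \<open>V\<close> and its set \<open>E\<close> of two-element edges.\<close>

definition path_between :: "'a set \<Rightarrow> 'a set set \<Rightarrow> 'a \<Rightarrow> 'a list \<Rightarrow> 'a \<Rightarrow> bool" where
  "path_between V E u p v \<longleftrightarrow>
     p \<noteq> [] \<and> hd p = u \<and> last p = v \<and> set p \<subseteq> V \<and> distinct p \<and>
     successively (\<lambda>x y. {x, y} \<in> E) p"

text \<open>The length of a path is its number of edges. The value is meaningful only if some path
  joins \<open>u\<close> and \<open>v\<close>, as is always the case in a connected graph.\<close>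

definition graph_dist :: "'a set \<Rightarrow> 'a set set \<Rightarrow> 'a \<Rightarrow> 'a \<Rightarrow> nat" where
  "graph_dist V E u v = (LEAST k. \<exists>p. path_between V E u p v \<and> length p = k + 1)"

text \<open>The linear order serves only to pick one representative \<open>u < v\<close> of every unordered pair
  of distinct vertices.\<close>

definition wiener_index :: "'a::linorder set \<Rightarrow> 'a set set \<Rightarrow> nat" where
  "wiener_index V E = (\<Sum>(u, v) \<in> {(u, v). u \<in> V \<and> v \<in> V \<and> u < v}. graph_dist V E u v)"

text \<open>The vertex \<open>j\<close> is encoded as \<open>(j, False)\<close> and the vertex \<open>j'\<close> as \<open>(j, True)\<close>.
  The case \<open>n = 1\<close> is exceptional: that graph has Wiener index 50, whereas
  \<open>32 * n ^ 3 + 16 * n ^ 2 + 4 * n\<close> gives 52.\<close>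

definition moebius_verts :: "nat \<Rightarrow> (nat \<times> bool) set" where
  "moebius_verts n = {1..4 * n} \<times> UNIV"

definition moebius_edges :: "nat \<Rightarrow> (nat \<times> bool) set set" where
  "moebius_edges n =
     {{(j, b), (j + 1, b)} | j b. 1 \<le> j \<and> j \<le> 4 * n - 1} \<union>
     {{(j, False), (j, True)} | j. 1 \<le> j \<and> j \<le> 4 * n \<and> (j mod 4 = 0 \<or> j mod 4 = 1)} \<union>
     {{(4 * n, False), (1, True)}, {(4 * n, True), (1, False)}}"

end

theory Submission
  imports Defs
begin

text \<open>Write \<open>N = 4n\<close> and \<open>t = |i - k|\<close>. Each closing edge continues the strip from position
  \<open>N\<close> to position 1 on the other side, so there are two reasonable ways to travel between
  positions \<open>i\<close> and \<open>k\<close>: directly along the strip, with \<open>t\<close> path edges, or through the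
  twist, with \<open>N - t\<close> edges and a change of side. If both vertices are on the same side,
  the second way needs a rung to change back, and the distance is \<open>min t (N - t + 1)\<close>. If
  they are on different sides, the first way needs a rung, and the distance is
  \<open>min (t + 1) (N - t)\<close>. A needed rung usually lies on the way taken. The only exception for
  \<open>n \<ge> 2\<close> is a pair on opposite sides with both positions among the two inner positions,
  congruent to 2 and 3 modulo 4, of one octagon: there the detour to a rung and back costs
  2 more. With \<open>f t = min t (N + 1 - t)\<close>, the distance from 0 to \<open>t\<close> in a cycle of length
  \<open>N + 1\<close>, the two values are \<open>f t\<close> and \<open>f (t + 1)\<close>, the latter plus 2 in the exceptional
  case.

  That this formula \<open>D\<close> is the distance from a fixed vertex \<open>u\<close> follows from two local
  facts: it changes by at most 1 along every edge, so no path can be shorter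
  (\<open>moebius_dist_lipschitz\<close>), and every vertex other than \<open>u\<close> has a neighbour where \<open>D\<close> is
  smaller by 1, so that a path of this length exists (\<open>moebius_dist_descent\<close>).

  For the sum, fix \<open>u\<close> at position \<open>i\<close>. The symmetry \<open>f (N + 1 - t) = f t\<close> makes the sum
  of \<open>f t + f (t + 1)\<close> over all positions \<open>k\<close> independent of \<open>i\<close>; it is \<open>8n\<^sup>2 + 4n - 1\<close>.
  An inner position contributes 4 in addition, 2 for each inner position of its octagon.
  There are \<open>8n\<close> vertices, half of which are inner, so twice the Wiener index is
  \<open>8n (8n\<^sup>2 + 4n - 1) + 16n\<close>.\<close>

section \<open>Distances from a potential function\<close>

lemma path_length_ge_potential:
  fixes D :: "'a \<Rightarrow> nat"
  assumes lip: "\<And>x y. {x, y} \<in> E \<Longrightarrow> D y \<le> D x + 1"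
    and "successively (\<lambda>x y. {x, y} \<in> E) p" "p \<noteq> []"
  shows "D (last p) + 1 \<le> D (hd p) + length p"
  using assms(2,3)
proof (induction p rule: induct_list012)
  case (3 x y zs)
  then have "{x, y} \<in> E" by simp
  from lip[OF this] 3 show ?case by simp
qed auto

text \<open>Following the descent from \<open>v\<close> down to \<open>u\<close> gives a path without repeated vertices,
  because the potential strictly decreases. The bound on the potential along the path is
  there to keep the induction going: it shows that the next vertex is new.\<close>

lemma descending_path:
  fixes D :: "'a \<Rightarrow> nat"
  assumes "u \<in> V"
    and zero: "\<And>v. v \<in> V \<Longrightarrow> D v = 0 \<Longrightarrow> v = u"
    and desc: "\<And>v. v \<in> V \<Longrightarrow> D v > 0 \<Longrightarrow> \<exists>w\<in>V. {w, v} \<in> E \<and> D v = D w + 1"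
    and "v \<in> V"
  shows "\<exists>p. path_between V E u p v \<and> length p = D v + 1 \<and> (\<forall>w\<in>set p. D w \<le> D v)"
  using \<open>v \<in> V\<close>
proof (induction "D v" arbitrary: v)
  case 0
  then have "v = u" using zero by simp
  then show ?case using 0 by (intro exI[of _ "[u]"]) (simp add: path_between_def)
next
  case (Suc d)
  then obtain w where w: "w \<in> V" "{w, v} \<in> E" "D v = D w + 1"
    using desc[of v] by auto
  with Suc obtain p where p: "path_between V E u p w" "length p = D w + 1" "\<forall>z\<in>set p. D z \<le> D w"
    by fastforce
  have "v \<notin> set p" using p(3) w(3) by force
  then have "path_between V E u (p @ [v]) v"
    using p(1) w(2) Suc.prems by (auto simp: path_between_def successively_append_iff)
  then show ?case using p w by (intro exI[of _ "p @ [v]"]) auto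
qed

text \<open>A potential that vanishes only at \<open>u\<close> is the distance from \<open>u\<close> as soon as it satisfies
  two conditions on neighbouring vertices: no edge raises it by more than 1, which bounds
  paths from below, and every vertex with a positive value has a neighbour one step lower,
  which produces a path.\<close>

lemma graph_dist_eq_potential:
  fixes D :: "'a \<Rightarrow> nat"
  assumes "u \<in> V" "D u = 0"
    and "\<And>v. v \<in> V \<Longrightarrow> D v = 0 \<Longrightarrow> v = u"
    and "\<And>v. v \<in> V \<Longrightarrow> D v > 0 \<Longrightarrow> \<exists>w\<in>V. {w, v} \<in> E \<and> D v = D w + 1"
    and lip: "\<And>x y. {x, y} \<in> E \<Longrightarrow> D y \<le> D x + 1"
    and "v \<in> V"
  shows "graph_dist V E u v = D v"
  unfolding graph_dist_def
proof (rule Least_equality)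
  show "\<exists>p. path_between V E u p v \<and> length p = D v + 1"
    using descending_path[OF assms(1,3,4) \<open>v \<in> V\<close>] by blast
next
  fix k assume "\<exists>p. path_between V E u p v \<and> length p = k + 1"
  then obtain p where "path_between V E u p v" "length p = k + 1" by blast
  then show "D v \<le> k"
    using path_length_ge_potential[of E D p, OF lip] \<open>D u = 0\<close>
    by (auto simp: path_between_def)
qed

section \<open>The Wiener index as a sum over ordered pairs\<close>

lemma path_between_rev: "path_between V E u p v \<Longrightarrow> path_between V E v (rev p) u"
  by (auto simp: path_between_def hd_rev last_rev insert_commute)

lemma graph_dist_commute: "graph_dist V E u v = graph_dist V E v u"
proof -
  have "(\<exists>p. path_between V E u p v \<and> length p = k + 1) \<longleftrightarrow>
        (\<exists>p. path_between V E v p u \<and> length p = k + 1)" for k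
    using path_between_rev by (metis length_rev)
  then show ?thesis by (simp add: graph_dist_def)
qed

lemma graph_dist_self: "u \<in> V \<Longrightarrow> graph_dist V E u u = 0"
  unfolding graph_dist_def
  by (rule Least_eq_0) (auto intro!: exI[of _ "[u]"] simp: path_between_def)

text \<open>Summing over ordered pairs frees the computation from the order on the vertices; every
  unordered pair is counted twice and the diagonal contributes 0.\<close>

lemma double_wiener_index:
  assumes "finite V"
  shows "2 * wiener_index V E = (\<Sum>u\<in>V. \<Sum>v\<in>V. graph_dist V E u v)"
proof -
  let ?d = "\<lambda>(u, v). graph_dist V E u v"
  let ?L = "{(u, v). u \<in> V \<and> v \<in> V \<and> u < v}" and ?G = "{(u, v). u \<in> V \<and> v \<in> V \<and> v < u}"
    and ?I = "{(u, v). u \<in> V \<and> v \<in> V \<and> u = v}"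
  have fin: "finite ?L" "finite ?G" "finite ?I"
    by (rule finite_subset[of _ "V \<times> V"]; use assms in auto)+
  have "V \<times> V = (?L \<union> ?G) \<union> ?I" by auto
  then have "sum ?d (V \<times> V) = sum ?d ((?L \<union> ?G) \<union> ?I)" by simp
  also have "\<dots> = sum ?d (?L \<union> ?G) + sum ?d ?I"
    using fin by (intro sum.union_disjoint) auto
  also have "sum ?d (?L \<union> ?G) = sum ?d ?L + sum ?d ?G"
    using fin by (intro sum.union_disjoint) auto
  also have "sum ?d ?I = 0"
    by (rule sum.neutral) (auto simp: graph_dist_self)
  also have "sum ?d ?G = sum ?d ?L"
    by (rule sum.reindex_bij_witness[of _ prod.swap prod.swap]) (auto simp: graph_dist_commute)
  finally show ?thesis
    by (simp add: wiener_index_def sum.cartesian_product)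
qed

section \<open>Distances in the Moebius graph\<close>

text \<open>The distance between two vertices \<open>t\<close> steps apart on a cycle of length \<open>N + 1\<close>. Such
  cycles arise here from the strip of \<open>N\<close> positions, closed up by the twist and one rung.\<close>

definition cycle_dist :: "nat \<Rightarrow> nat \<Rightarrow> nat" where
  "cycle_dist N t = min t (N + 1 - t)"

text \<open>Two positions are related if the stretch between them, ends included, contains no rung.
  The rungs sit at the positions congruent to 0 and 1 modulo 4, so both positions must
  then be inner positions of the same octagon.\<close>

definition rungless :: "nat \<Rightarrow> nat \<Rightarrow> bool" where
  "rungless i k \<longleftrightarrow> i div 4 = k div 4 \<and> i mod 4 \<in> {2, 3} \<and> k mod 4 \<in> {2, 3}"

definition gap :: "nat \<Rightarrow> nat \<Rightarrow> nat" where
  "gap i k = (i - k) + (k - i)"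

text \<open>On the same side, a rung is paid for on the way through the twist; on different sides,
  on the direct way. The latter turns \<open>t\<close> into \<open>t + 1\<close> and leaves
  \<open>N - t = N + 1 - (t + 1)\<close> for the way through the twist, which is why the same function
  occurs with its argument shifted by one.\<close>

fun moebius_dist :: "nat \<Rightarrow> nat \<times> bool \<Rightarrow> nat \<times> bool \<Rightarrow> nat" where
  "moebius_dist n (i, b) (k, c) =
     (if b = c then cycle_dist (4 * n) (gap i k)
      else cycle_dist (4 * n) (gap i k + 1) + (if rungless i k then 2 else 0))"

lemma moebius_edge_cases:
  assumes "{x, y} \<in> moebius_edges n"
  obtains (path) j b where "1 \<le> j" "j < 4 * n" "{x, y} = {(j, b), (j + 1, b)}"
  | (rung) j b where "1 \<le> j" "j \<le> 4 * n" "j mod 4 = 0 \<or> j mod 4 = 1" "{x, y} = {(j, b), (j, \<not> b)}"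
  | (twist) b where "{x, y} = {(4 * n, b), (1, \<not> b)}"
proof -
  from assms consider
      (1) "\<exists>j b. {x, y} = {(j, b), (j + 1, b)} \<and> 1 \<le> j \<and> j \<le> 4 * n - 1"
    | (2) "\<exists>j. {x, y} = {(j, False), (j, True)} \<and> 1 \<le> j \<and> j \<le> 4 * n \<and> (j mod 4 = 0 \<or> j mod 4 = 1)"
    | (3) "{x, y} = {(4 * n, False), (1, True)}"
    | (4) "{x, y} = {(4 * n, True), (1, False)}"
    unfolding moebius_edges_def Un_iff mem_Collect_eq insert_iff empty_iff by argo
  then show ?thesis
  proof cases
    case 1
    then obtain j b where "{x, y} = {(j, b), (j + 1, b)}" "1 \<le> j" "j \<le> 4 * n - 1"
      by (elim exE conjE)
    then show ?thesis by (intro path[of j b]) simp_all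
  next
    case 2
    then obtain j where "{x, y} = {(j, False), (j, True)}" "1 \<le> j" "j \<le> 4 * n"
      "j mod 4 = 0 \<or> j mod 4 = 1" by (elim exE conjE)
    then show ?thesis by (intro rung[of j False]) simp_all
  next
    case 3 then show ?thesis by (intro twist[of False]) simp
  next
    case 4 then show ?thesis by (intro twist[of True]) simp
  qed
qed

lemma moebius_edgeI:
  "1 \<le> j \<Longrightarrow> j < 4 * n \<Longrightarrow> {(j, b), (j + 1, b)} \<in> moebius_edges n"
  "1 \<le> j \<Longrightarrow> j \<le> 4 * n \<Longrightarrow> j mod 4 = 0 \<or> j mod 4 = 1 \<Longrightarrow> {(j, b), (j, \<not> b)} \<in> moebius_edges n"
  "{(4 * n, b), (1, \<not> b)} \<in> moebius_edges n"
proof -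
  show "{(j, b), (j + 1, b)} \<in> moebius_edges n" if "1 \<le> j" "j < 4 * n"
  proof -
    have "j \<le> 4 * n - 1" using that by simp
    with that show ?thesis unfolding moebius_edges_def by blast
  qed
  show "{(j, b), (j, \<not> b)} \<in> moebius_edges n"
    if "1 \<le> j" "j \<le> 4 * n" "j mod 4 = 0 \<or> j mod 4 = 1"
  proof -
    have "{(j, b), (j, \<not> b)} = {(j, False), (j, True)}" by (cases b) (simp_all add: insert_commute)
    with that show ?thesis
      unfolding moebius_edges_def by (intro UnI1 UnI2 CollectI exI[of _ j] conjI)
  qed
  show "{(4 * n, b), (1, \<not> b)} \<in> moebius_edges n"
    unfolding moebius_edges_def by (rule UnI2, cases b) simp_all
qed

text \<open>For a fixed \<open>i\<close> the only candidates are \<open>i\<close> itself and the other inner position of its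
  octagon.\<close>

lemma rungless_iff:
  "rungless i k \<longleftrightarrow> i mod 4 = 2 \<and> (k = i \<or> k = i + 1) \<or> i mod 4 = 3 \<and> (k = i \<or> i = k + 1)"
proof
  assume "rungless i k"
  moreover have "i = 4 * (i div 4) + i mod 4" "k = 4 * (k div 4) + k mod 4" by simp_all
  ultimately show "i mod 4 = 2 \<and> (k = i \<or> k = i + 1) \<or> i mod 4 = 3 \<and> (k = i \<or> i = k + 1)"
    unfolding rungless_def by (elim conjE insertE emptyE) linarith+
next
  assume "i mod 4 = 2 \<and> (k = i \<or> k = i + 1) \<or> i mod 4 = 3 \<and> (k = i \<or> i = k + 1)"
  then show "rungless i k"
    by (auto simp: rungless_def mod_Suc div_Suc split: if_splits)
qed

lemma rungless_imp_gap_le_1: "rungless i k \<Longrightarrow> gap i k \<le> 1"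
  by (auto simp: rungless_iff gap_def)

text \<open>The outer neighbour of an inner position carries a rung, and the inner one lies in the
  same octagon. Hence a step along the strip from an inner position never makes a detour
  necessary that was not needed before.\<close>

lemma not_rungless_step:
  assumes "k mod 4 = 2 \<or> k mod 4 = 3" "\<not> rungless i k"
  shows "\<not> rungless i (k + 1)" "\<not> rungless i (k - 1)"
proof -
  show "\<not> rungless i (k + 1)"
    using assms by (auto simp: rungless_def mod_Suc div_Suc)
  show "\<not> rungless i (k - 1)"
  proof (cases k)
    case (Suc k')
    then show ?thesis using assms by (auto simp: rungless_def mod_Suc div_Suc split: if_splits)
  qed (use assms in simp)
qed

text \<open>Along path edges the gap changes by one. The detour term is switched on or off only
  where the gap is at most 2; there the numbers \<open>1, 2, 3\<close> are below \<open>N / 2\<close> because of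
  \<open>n \<ge> 2\<close>, so all values are explicit. A rung exchanges \<open>f t\<close> and \<open>f (t + 1)\<close>. At a
  closing edge the gaps are \<open>i - 1\<close> and \<open>N - i\<close>; one of the two values is \<open>f\<close> at its gap,
  the other is \<open>f\<close> at its gap plus 1, and \<open>f i = f (N + 1 - i)\<close> shows that they are values
  at consecutive arguments.\<close>

lemma moebius_dist_lipschitz:
  assumes "n \<ge> 2" "1 \<le> i" "i \<le> 4 * n" "{x, y} \<in> moebius_edges n"
  shows "moebius_dist n (i, b) y \<le> moebius_dist n (i, b) x + 1"
proof -
  define N where "N = 4 * n"
  have N: "N \<ge> 8" "i \<le> N" "N mod 4 = 0" using assms by (auto simp: N_def)
  have cycle_step: "cycle_dist N (gap i j + a) \<le> cycle_dist N (gap i (j + 1) + a) + 1"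
    "cycle_dist N (gap i (j + 1) + a) \<le> cycle_dist N (gap i j + a) + 1" for j a
  proof -
    have "cycle_dist N (Suc t) \<le> cycle_dist N t + 1" "cycle_dist N t \<le> cycle_dist N (Suc t) + 1" for t
      by (auto simp: cycle_dist_def)
    moreover have "gap i (j + 1) = Suc (gap i j) \<or> gap i j = Suc (gap i (j + 1))"
      by (auto simp: gap_def)
    ultimately show "cycle_dist N (gap i j + a) \<le> cycle_dist N (gap i (j + 1) + a) + 1"
      "cycle_dist N (gap i (j + 1) + a) \<le> cycle_dist N (gap i j + a) + 1"
      by (metis add_Suc)+
  qed
  have small: "cycle_dist N 1 = 1" "cycle_dist N 2 = 2" "cycle_dist N 3 = 3"
    using N by (auto simp: cycle_dist_def)
  have opp: "cycle_dist N (gap i j + 1) + (if rungless i j then 2 else 0)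
        \<le> cycle_dist N (gap i (j + 1) + 1) + (if rungless i (j + 1) then 2 else 0) + 1"
      (is ?A)
      "cycle_dist N (gap i (j + 1) + 1) + (if rungless i (j + 1) then 2 else 0)
        \<le> cycle_dist N (gap i j + 1) + (if rungless i j then 2 else 0) + 1" (is ?B) for j
  proof -
    consider (plain) "rungless i j \<longleftrightarrow> rungless i (j + 1)"
      | (leave) "rungless i j" "\<not> rungless i (j + 1)"
      | (enter) "\<not> rungless i j" "rungless i (j + 1)"
      by blast
    then have "?A \<and> ?B"
    proof cases
      case plain
      then show ?thesis using cycle_step[of j 1] by simp
    next
      case leave
      then have "i = j \<or> j = i + 1" by (auto simp: rungless_iff)
      then show ?thesis using leave(1,2) small by (auto simp: gap_def numeral_eq_Suc)
    next
      case enter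
      then have "i = j + 1 \<or> i = j + 2" by (auto simp: rungless_iff)
      then show ?thesis using enter(1,2) small by (auto simp: gap_def numeral_eq_Suc)
    qed
    then show ?A ?B by auto
  qed
  have nr: "\<not> rungless i j" if "j mod 4 = 0 \<or> j mod 4 = 1" for j
    using that by (auto simp: rungless_def)
  from assms(4) show ?thesis
  proof (cases rule: moebius_edge_cases)
    case (path j c)
    then show ?thesis using cycle_step[of j 0] opp[of j] by (auto simp: doubleton_eq_iff N_def)
  next
    case (rung j c)
    then show ?thesis using nr[of j] by (auto simp: doubleton_eq_iff cycle_dist_def)
  next
    case (twist c)
    have "gap i 1 = i - 1" "gap i N = N - i" using assms N by (auto simp: gap_def)
    moreover have "\<not> rungless i 1" "\<not> rungless i N" using nr N by auto
    ultimately show ?thesis using twist assms N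
      by (auto simp: doubleton_eq_iff cycle_dist_def N_def)
  qed
qed

text \<open>The neighbour is found by taking the first step of a shortest route from \<open>v\<close> back to the
  source at position \<open>i\<close>. If the direct way is shortest, step towards \<open>i\<close>, but change the
  side first if that is required and a rung is at hand; if the way through the twist is
  shortest, step away from \<open>i\<close>, over a closing edge at the end of the strip. In the
  exceptional case, step to the adjacent rung if \<open>v\<close> is at position \<open>i\<close>, and to position
  \<open>i\<close> otherwise.\<close>

lemma moebius_dist_descent:
  assumes "n \<ge> 2" "1 \<le> i" "i \<le> 4 * n" "v \<in> moebius_verts n" "moebius_dist n (i, b) v > 0"
  shows "\<exists>w \<in> moebius_verts n. {w, v} \<in> moebius_edges n \<and>
           moebius_dist n (i, b) v = moebius_dist n (i, b) w + 1"
proof -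
  define N where "N = 4 * n"
  obtain k c where v: "v = (k, c)" by force
  have k: "1 \<le> k" "k \<le> N" using assms(4) by (auto simp: v moebius_verts_def N_def)
  have N: "N \<ge> 8" "i \<le> N" "N mod 4 = 0" "1 \<le> i" using assms by (auto simp: N_def)
  let ?D = "\<lambda>k c. moebius_dist n (i, b) (k, c)"
  let ?goal = "\<exists>w \<in> moebius_verts n. {w, (k, c)} \<in> moebius_edges n \<and> ?D k c = moebius_dist n (i, b) w + 1"
  have down: ?goal if "k > 1" "?D k c = ?D (k - 1) c + 1"
    using that k moebius_edgeI(1)[of "k - 1" n c]
    by (intro bexI[of _ "(k - 1, c)"]) (auto simp: moebius_verts_def N_def insert_commute)
  have up: ?goal if "k < N" "?D k c = ?D (k + 1) c + 1"
    using that k moebius_edgeI(1)[of k n c]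
    by (intro bexI[of _ "(k + 1, c)"]) (auto simp: moebius_verts_def N_def insert_commute)
  have cross: ?goal if "k mod 4 = 0 \<or> k mod 4 = 1" "?D k c = ?D k (\<not> c) + 1"
    using that k moebius_edgeI(2)[of k n c]
    by (intro bexI[of _ "(k, \<not> c)"]) (auto simp: moebius_verts_def N_def insert_commute)
  have twist_up: ?goal if "k = N" "?D k c = ?D 1 (\<not> c) + 1"
    using that k moebius_edgeI(3)[of n c]
    by (intro bexI[of _ "(1, \<not> c)"]) (auto simp: moebius_verts_def N_def insert_commute)
  have twist_down: ?goal if "k = 1" "?D k c = ?D N (\<not> c) + 1"
    using that k moebius_edgeI(3)[of n "\<not> c"]
    by (intro bexI[of _ "(N, \<not> c)"]) (auto simp: moebius_verts_def N_def insert_commute)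
  have ends: "gap i 1 = i - 1" "gap i N = N - i" "\<not> rungless i 1" "\<not> rungless i N"
    using N by (auto simp: gap_def rungless_def)
  consider (same) "b = c" | (opp) "c = (\<not> b)" by auto
  then have ?goal
  proof cases
    case same
    show ?thesis
    proof (cases "2 * gap i k \<le> N + 1")
      case True
      consider "k < i" | "i < k" using assms(5) by (cases "i = k") (auto simp: same v cycle_dist_def gap_def)
      then show ?thesis
      proof cases
        case 1
        then show ?thesis using True k N by (intro up) (auto simp: same N_def[symmetric] cycle_dist_def gap_def)
      next
        case 2
        then show ?thesis using True k N by (intro down) (auto simp: same N_def[symmetric] cycle_dist_def gap_def)
      qed
    next
      case False
      consider "k < i" "k > 1" | "k < i" "k = 1" | "i < k" "k < N" | "i < k" "k = N"
        using False k by (force simp: gap_def)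
      then show ?thesis
      proof cases
        case 1
        then show ?thesis using False k N by (intro down) (auto simp: same N_def[symmetric] cycle_dist_def gap_def)
      next
        case 2
        then show ?thesis using False k N ends by (intro twist_down) (auto simp: same N_def[symmetric] cycle_dist_def)
      next
        case 3
        then show ?thesis using False k N by (intro up) (auto simp: same N_def[symmetric] cycle_dist_def gap_def)
      next
        case 4
        then show ?thesis using False k N ends by (intro twist_up) (auto simp: same N_def[symmetric] cycle_dist_def)
      qed
    qed
  next
    case opp
    have Dopp: "?D k' c = cycle_dist N (gap i k' + 1) + (if rungless i k' then 2 else 0)"
      "?D k' (\<not> c) = cycle_dist N (gap i k')" for k'
      by (simp_all add: opp N_def)
    have small: "cycle_dist N (Suc 0) = 1" "cycle_dist N (Suc (Suc 0)) = 2"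
      using N by (auto simp: cycle_dist_def)
    show ?thesis
    proof (cases "rungless i k")
      case True
      then consider "i mod 4 = 2" "k = i" | "i mod 4 = 2" "k = i + 1"
        | "i mod 4 = 3" "k = i" | "i mod 4 = 3" "i = k + 1"
        unfolding rungless_iff by blast
      then show ?thesis
      proof cases
        case 1
        have "k > 1" using 1 k by (cases "k = 1") auto
        have "(k - 1) mod 4 = 1" using 1 by (cases k) (auto simp: mod_Suc split: if_splits)
        then have "\<not> rungless i (k - 1)" by (simp add: rungless_def)
        moreover have "gap i k = 0" "gap i (k - 1) = 1" using 1 \<open>k > 1\<close> by (auto simp: gap_def)
        ultimately show ?thesis using True small \<open>k > 1\<close>
          by (intro down) (simp_all add: Dopp del: moebius_dist.simps)
      next
        case 2
        then have "rungless i (k - 1)" "gap i k = 1" "gap i (k - 1) = 0" "k > 1"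
          using N by (simp_all add: rungless_iff gap_def)
        then show ?thesis using True small
          by (intro down) (simp_all add: Dopp del: moebius_dist.simps)
      next
        case 3
        have "k < N" using 3 N by (cases "k = N") auto
        have "\<not> rungless i (k + 1)" "gap i k = 0" "gap i (k + 1) = 1"
          using 3 by (auto simp: rungless_iff gap_def)
        then show ?thesis using True small \<open>k < N\<close>
          by (intro up) (simp_all add: Dopp del: moebius_dist.simps)
      next
        case 4
        then have "rungless i (k + 1)" "gap i k = 1" "gap i (k + 1) = 0" "k < N"
          using N by (simp_all add: rungless_iff gap_def)
        then show ?thesis using True small
          by (intro up) (simp_all add: Dopp del: moebius_dist.simps)
      qed
    next
      case plain: False
      \<comment> \<open>The direct way, \<open>gap + 1\<close> edges long, is compared with \<open>N - gap\<close> for the way through the twist.\<close>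
      show ?thesis
      proof (cases "2 * gap i k + 1 \<le> N")
        case near: True
        then have step: "cycle_dist N (gap i k + 1) = cycle_dist N (gap i k) + 1" by (auto simp: cycle_dist_def)
        show ?thesis
        proof (cases "k mod 4 = 0 \<or> k mod 4 = 1")
          case True
          then show ?thesis
            by (rule cross) (simp only: Dopp plain step if_False add_0_right)
        next
          case False
          then have inner: "k mod 4 = 2 \<or> k mod 4 = 3" by linarith
          then have "i \<noteq> k" using plain by (auto simp: rungless_iff)
          then consider "k < i" | "i < k" by linarith
          then show ?thesis
          proof cases
            case 1
            then have "gap i k = gap i (k + 1) + 1" by (auto simp: gap_def)
            then show ?thesis using 1 k N near plain not_rungless_step[OF inner plain]
              by (intro up) (simp_all add: Dopp cycle_dist_def del: moebius_dist.simps)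
          next
            case 2
            then have "gap i k = gap i (k - 1) + 1" by (auto simp: gap_def)
            then show ?thesis using 2 k N near plain not_rungless_step[OF inner plain]
              by (intro down) (simp_all add: Dopp cycle_dist_def del: moebius_dist.simps)
          qed
        qed
      next
        case far: False
        have nr: "\<not> rungless i (k + 1)" "\<not> rungless i (k - 1)"
        proof -
          have "gap i k \<ge> 4" using far N by linarith
          moreover have "gap i k \<le> gap i (k + 1) + 1" "gap i k \<le> gap i (k - 1) + 1"
            by (auto simp: gap_def)
          ultimately show "\<not> rungless i (k + 1)" "\<not> rungless i (k - 1)"
            using rungless_imp_gap_le_1 by fastforce+
        qed
        consider "k < i" "k > 1" | "k < i" "k = 1" | "i < k" "k < N" | "i < k" "k = N"
          using far k N by (force simp: gap_def)
        then show ?thesis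
        proof cases
          case 1
          then show ?thesis using far k N nr plain
            by (intro down) (auto simp: Dopp cycle_dist_def gap_def simp del: moebius_dist.simps)
        next
          case 2
          then show ?thesis using far k N ends plain
            by (intro twist_down) (auto simp: Dopp cycle_dist_def simp del: moebius_dist.simps)
        next
          case 3
          then show ?thesis using far k N nr plain
            by (intro up) (auto simp: Dopp cycle_dist_def gap_def simp del: moebius_dist.simps)
        next
          case 4
          then show ?thesis using far k N ends plain
            by (intro twist_up) (auto simp: Dopp cycle_dist_def simp del: moebius_dist.simps)
        qed
      qed
    qed
  qed
  then show ?thesis by (simp only: v)
qed

lemma graph_dist_moebius:
  assumes "n \<ge> 2" "u \<in> moebius_verts n" "v \<in> moebius_verts n"
  shows "graph_dist (moebius_verts n) (moebius_edges n) u v = moebius_dist n u v"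
proof -
  obtain i b where u: "u = (i, b)" by force
  have i: "1 \<le> i" "i \<le> 4 * n" using assms(2) by (auto simp: u moebius_verts_def)
  show ?thesis
  proof (rule graph_dist_eq_potential)
    show "moebius_dist n u u = 0" by (simp add: u cycle_dist_def gap_def)
    show "w = u" if "w \<in> moebius_verts n" "moebius_dist n u w = 0" for w
      using that i by (cases w) (auto simp: u moebius_verts_def cycle_dist_def gap_def min_def split: if_splits)
    show "\<exists>x\<in>moebius_verts n. {x, w} \<in> moebius_edges n \<and> moebius_dist n u w = moebius_dist n u x + 1"
      if "w \<in> moebius_verts n" "moebius_dist n u w > 0" for w
      using moebius_dist_descent[OF assms(1) i] that by (simp only: u)
    show "moebius_dist n u y \<le> moebius_dist n u x + 1" if "{x, y} \<in> moebius_edges n" for x y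
      using moebius_dist_lipschitz[OF assms(1) i that] by (simp only: u)
  qed (use assms in simp_all)
qed

section \<open>Summation\<close>

lemma sum_cycle_dist: "(\<Sum>t = 1..2 * m. cycle_dist (2 * m) t) = m * (m + 1)"
proof -
  have "(\<Sum>t = 1..2 * m. cycle_dist (2 * m) t)
      = (\<Sum>t = 1..m. cycle_dist (2 * m) t) + (\<Sum>t = m + 1..2 * m. cycle_dist (2 * m) t)"
    using sum.ub_add_nat[of 1 m "cycle_dist (2 * m)" m] by (simp add: mult_2)
  also have "(\<Sum>t = m + 1..2 * m. cycle_dist (2 * m) t) = (\<Sum>t = 1..m. cycle_dist (2 * m) t)"
    by (rule sum.reindex_bij_witness[of _ "\<lambda>t. 2 * m + 1 - t" "\<lambda>t. 2 * m + 1 - t"])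
       (auto simp: cycle_dist_def)
  also have "(\<Sum>t = 1..m. cycle_dist (2 * m) t) = (\<Sum>t = 1..m. t)"
    by (intro sum.cong) (auto simp: cycle_dist_def)
  finally show ?thesis
    using gauss_sum_from_Suc_0[where 'a = nat, of m] by (simp add: mult_2[symmetric])
qed

text \<open>The independence of \<open>i\<close> comes from gluing four pieces. For \<open>k \<le> i\<close> the values \<open>f t\<close> have
  \<open>t\<close> running over \<open>0..i-1\<close>, and the values \<open>f (t + 1)\<close> run over \<open>f 1, ..., f i\<close>. For
  \<open>k > i\<close>, reflection \<open>t \<mapsto> N + 1 - t\<close> moves the arguments to \<open>i+1..N\<close> and \<open>i..N-1\<close>,
  respectively. Together they cover \<open>0..N-1\<close> and \<open>1..N\<close> once each, and the two sums differ
  by \<open>f N - f 0 = 1\<close>.\<close>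

lemma sum_cycle_dist_gap:
  assumes "1 \<le> i" "i \<le> N"
  shows "(\<Sum>k = 1..N. cycle_dist N (gap i k) + cycle_dist N (gap i k + 1)) + 1 = 2 * (\<Sum>t = 1..N. cycle_dist N t)"
proof -
  let ?f = "cycle_dist N"
  have split: "sum g {1..N} = sum g {1..i} + sum g {i + 1..N}" for g :: "nat \<Rightarrow> nat"
    using assms sum.ub_add_nat[of 1 i g "N - i"] by simp
  have low: "(\<Sum>k = 1..i. ?f (gap i k)) = (\<Sum>t = 0..<i. ?f t)"
    by (rule sum.reindex_bij_witness[of _ "\<lambda>t. i - t" "\<lambda>k. i - k"]) (auto simp: gap_def)
  have high': "(\<Sum>k = i + 1..N. ?f (gap i k + 1)) = (\<Sum>t = i..<N. ?f t)"
    by (rule sum.reindex_bij_witness[of _ "\<lambda>t. N + i - t" "\<lambda>k. N + i - k"])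
       (auto simp: gap_def cycle_dist_def)
  have concat: "(\<Sum>t = 0..<i. ?f t) + (\<Sum>t = i..<N. ?f t) = (\<Sum>t = 0..<N. ?f t)"
    using assms by (intro sum.atLeastLessThan_concat) auto
  have low': "(\<Sum>k = 1..i. ?f (gap i k + 1)) = (\<Sum>t = 1..i. ?f t)"
    by (rule sum.reindex_bij_witness[of _ "\<lambda>t. i + 1 - t" "\<lambda>k. i + 1 - k"])
       (auto simp: gap_def Suc_diff_le)
  have high: "(\<Sum>k = i + 1..N. ?f (gap i k)) = (\<Sum>t = i + 1..N. ?f t)"
    by (rule sum.reindex_bij_witness[of _ "\<lambda>t. N + 1 + i - t" "\<lambda>k. N + 1 + i - k"])
       (auto simp: gap_def cycle_dist_def)
  have shift: "(\<Sum>t = 0..<N. ?f t) + 1 = (\<Sum>t = 1..N. ?f t)"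
  proof -
    have "(\<Sum>t = 0..<N. ?f t) + ?f N = ?f 0 + (\<Sum>t = 1..N. ?f t)"
      by (metis sum.atLeast0_lessThan_Suc atLeastLessThanSuc_atLeastAtMost sum.atLeast_Suc_atMost le0 One_nat_def)
    then show ?thesis using assms by (simp add: cycle_dist_def)
  qed
  have "(\<Sum>k = 1..N. ?f (gap i k) + ?f (gap i k + 1)) + 1
      = ((\<Sum>t = 0..<i. ?f t) + (\<Sum>t = i + 1..N. ?f t))
        + ((\<Sum>t = 1..i. ?f t) + (\<Sum>t = i..<N. ?f t)) + 1"
    by (simp only: sum.distrib split[of "\<lambda>k. ?f (gap i k)"] split[of "\<lambda>k. ?f (gap i k + 1)"]
        low low' high high')
  also have "\<dots> = ((\<Sum>t = 0..<i. ?f t) + (\<Sum>t = i..<N. ?f t) + 1)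
        + ((\<Sum>t = 1..i. ?f t) + (\<Sum>t = i + 1..N. ?f t))"
    by simp
  also have "\<dots> = 2 * (\<Sum>t = 1..N. ?f t)"
    by (simp only: concat shift split[of ?f, symmetric] mult_2)
  finally show ?thesis .
qed

text \<open>An inner position has exactly two rungless partners: itself and its inner neighbour.\<close>

lemma sum_rungless:
  assumes "i \<le> 4 * n"
  shows "(\<Sum>k = 1..4 * n. if rungless i k then 2 else 0) = (if i mod 4 \<in> {2, 3} then 4 else (0 :: nat))"
proof -
  have "(\<Sum>k = 1..4 * n. if rungless i k then 2 else 0) = 2 * card {k \<in> {1..4 * n}. rungless i k}"
    by (simp flip: sum.inter_filter)
  also consider "i mod 4 = 2" | "i mod 4 = 3" | "i mod 4 \<notin> {2, 3}" by auto
  then have "card {k \<in> {1..4 * n}. rungless i k} = (if i mod 4 \<in> {2, 3} then 2 else 0)"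
  proof cases
    case 1
    then have "1 \<le> i" by (cases i) auto
    moreover have "i < 4 * n" using 1 assms by (cases "i = 4 * n") auto
    ultimately have "{k \<in> {1..4 * n}. rungless i k} = {i, i + 1}"
      using 1 by (auto simp: rungless_iff)
    then show ?thesis using 1 by simp
  next
    case 2
    then have "2 \<le> i" by (cases "i = 0 \<or> i = 1") auto
    then have "{k \<in> {1..4 * n}. rungless i k} = {i - 1, i}"
      using 2 assms by (auto simp: rungless_iff)
    then show ?thesis using 2 \<open>2 \<le> i\<close> by (simp add: card_insert_if)
  next
    case 3
    then have "{k \<in> {1..4 * n}. rungless i k} = {}" by (auto simp: rungless_def)
    then show ?thesis using 3 by auto
  qed
  finally show ?thesis by simp
qed

lemma sum_moebius_verts:
  "(\<Sum>v\<in>moebius_verts n. g v) = (\<Sum>i = 1..4 * n. \<Sum>b\<in>UNIV. g (i, b))"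
  by (simp add: moebius_verts_def sum.cartesian_product split_def)

text \<open>The 1 on the left stands for a subtraction on the right, where \<open>8n\<^sup>2 + 4n - 1\<close> is the
  value for positions with a rung.\<close>

lemma transmission_moebius:
  assumes "1 \<le> i" "i \<le> 4 * n"
  shows "(\<Sum>v\<in>moebius_verts n. moebius_dist n (i, b) v) + 1
       = 8 * n\<^sup>2 + 4 * n + (if i mod 4 \<in> {2, 3} then 4 else 0)"
proof -
  have "(\<Sum>v\<in>moebius_verts n. moebius_dist n (i, b) v)
      = (\<Sum>k = 1..4 * n. \<Sum>c\<in>UNIV. moebius_dist n (i, b) (k, c))"
    by (rule sum_moebius_verts)
  also have "\<dots> = (\<Sum>k = 1..4 * n. (cycle_dist (4 * n) (gap i k) + cycle_dist (4 * n) (gap i k + 1))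
                   + (if rungless i k then 2 else 0))"
    by (rule sum.cong) (auto simp: UNIV_bool)
  also have "\<dots> + 1 = 2 * (\<Sum>t = 1..4 * n. cycle_dist (4 * n) t) + (if i mod 4 \<in> {2, 3} then 4 else 0)"
    using sum_cycle_dist_gap[OF assms] sum_rungless[OF assms(2)] by (simp only: sum.distrib)
  also have "(\<Sum>t = 1..4 * n. cycle_dist (4 * n) t) = 2 * n * (2 * n + 1)"
    using sum_cycle_dist[of "2 * n"] by simp
  finally show ?thesis by (simp add: power2_eq_square algebra_simps)
qed

lemma sum_inner_positions:
  "(\<Sum>i = 1..4 * n. if i mod 4 \<in> {2, 3} then 4 else (0 :: nat)) = 8 * n"
proof (induction n)
  case (Suc n)
  have "4 * Suc n = Suc (Suc (Suc (Suc (4 * n))))" by simp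
  moreover have "Suc (4 * n) mod 4 = 1" "Suc (Suc (4 * n)) mod 4 = 2"
    "Suc (Suc (Suc (4 * n))) mod 4 = 3" "Suc (Suc (Suc (Suc (4 * n)))) mod 4 = 0"
    by presburger+
  ultimately show ?case using Suc by (simp only: sum.cl_ivl_Suc) simp
qed simp

theorem theorem4p1:
  fixes n :: nat
  assumes "n \<ge> 2"
  shows "wiener_index (moebius_verts n) (moebius_edges n) = 32 * n ^ 3 + 16 * n ^ 2 + 4 * n"
proof -
  let ?V = "moebius_verts n" and ?E = "moebius_edges n"
  let ?T = "\<lambda>u. \<Sum>v\<in>?V. moebius_dist n u v"
  have "2 * wiener_index ?V ?E = (\<Sum>u\<in>?V. \<Sum>v\<in>?V. graph_dist ?V ?E u v)"
    by (rule double_wiener_index) (simp add: moebius_verts_def)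
  also have "\<dots> = (\<Sum>u\<in>?V. ?T u)"
    using assms by (intro sum.cong refl) (simp add: graph_dist_moebius)
  also have "\<dots> = (\<Sum>i = 1..4 * n. \<Sum>b\<in>UNIV. ?T (i, b))"
    by (rule sum_moebius_verts)
  also have "\<dots> + 8 * n = (\<Sum>i = 1..4 * n. \<Sum>b\<in>UNIV. ?T (i, b) + 1)"
    by (simp only: sum.distrib) simp
  also have "\<dots> = (\<Sum>i = 1..4 * n. 2 * (8 * n\<^sup>2 + 4 * n + (if i mod 4 \<in> {2, 3} then 4 else 0)))"
    by (intro sum.cong refl) (simp only: atLeastAtMost_iff transmission_moebius, simp)
  also have "\<dots> = 2 * (\<Sum>i = 1..4 * n. 8 * n\<^sup>2 + 4 * n + (if i mod 4 \<in> {2, 3} then 4 else 0))"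
    by (rule sum_distrib_left[symmetric])
  also have "\<dots> = 2 * (4 * n * (8 * n\<^sup>2 + 4 * n) + 8 * n)"
    by (simp only: sum.distrib[of "\<lambda>_. 8 * n\<^sup>2 + 4 * n"] sum_inner_positions sum_constant) simp
  also have "\<dots> = 64 * n ^ 3 + 32 * n\<^sup>2 + 16 * n"
    by algebra
  finally show ?thesis by simp
qed

end
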